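(* Let $H$ be an infinite-dimensional separable complex Hilbert space, and let $\mathcal{N}_U$ denote the set of all unitary equivalence classes of normal operators on $H$. Then $|\mathcal{N}_U|=\mathfrak{c}$.
   Context: $\mathfrak{c}$ denotes the cardinality of the continuum and $|X|$ the cardinality of a set $X$. Normal operators are bounded linear operators $N$ on $H$ with $N^*N=NN^*$; two operators $N,M$ on $H$ are unitarily equivalent if $M=V^{-1}NV$ for some unitary operator $V$ on $H$. *)

theory Defs
  imports "HOL-Analysis.Analysis"
begin

text \<open>
  Complex inner product spaces, as real normed spaces carrying a compatible complex scalar
  multiplication and a Hermitian form that induces the norm; the form is linear in its first
  argument. Positive definiteness of the form is a consequence of the axiom \<open>cinner_norm\<close>.
\<close>

class complex_inner = real_normed_vector +
  fixes scaleC :: "complex \<Rightarrow> 'a \<Rightarrow> 'a" (infixr \<open>*\<^sub>C\<close> 75)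
    and cinner :: "'a \<Rightarrow> 'a \<Rightarrow> complex"
  assumes scaleC_add_right: "a *\<^sub>C (x + y) = a *\<^sub>C x + a *\<^sub>C y"
    and scaleC_add_left: "(a + b) *\<^sub>C x = a *\<^sub>C x + b *\<^sub>C x"
    and scaleC_scaleC: "a *\<^sub>C b *\<^sub>C x = (a * b) *\<^sub>C x"
    and scaleR_scaleC: "r *\<^sub>R x = complex_of_real r *\<^sub>C x"
    and cinner_commute: "cinner x y = cnj (cinner y x)"
    and cinner_add_left: "cinner (x + y) z = cinner x z + cinner y z"
    and cinner_scaleC_left: "cinner (a *\<^sub>C x) y = a * cinner x y"
    and cinner_norm: "cinner x x = complex_of_real ((norm x)\<^sup>2)"

class chilbert_space = complex_inner + banach

global_interpretation complex_vector:
  vector_space "scaleC :: complex \<Rightarrow> 'a \<Rightarrow> 'a::complex_inner"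
proof unfold_locales
  fix x :: 'a
  show "1 *\<^sub>C x = x"
    using scaleR_scaleC[of 1 x] by simp
qed (simp_all add: scaleC_add_right scaleC_add_left scaleC_scaleC)

instantiation complex :: chilbert_space
begin

definition scaleC_complex :: "complex \<Rightarrow> complex \<Rightarrow> complex"
  where "scaleC_complex a x = a * x"

definition cinner_complex :: "complex \<Rightarrow> complex \<Rightarrow> complex"
  where "cinner_complex x y = x * cnj y"

instance
proof
  fix x :: complex
  show "cinner x x = complex_of_real ((norm x)\<^sup>2)"
    by (metis cinner_complex_def complex_norm_square)
qed (simp_all add: scaleC_complex_def cinner_complex_def scaleR_conv_of_real algebra_simps)

end

definition bounded_clinear :: "('a::complex_inner \<Rightarrow> 'b::complex_inner) \<Rightarrow> bool"
  where "bounded_clinear N \<longleftrightarrow>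
    Vector_Spaces.linear scaleC scaleC N \<and> (\<exists>K. \<forall>x. norm (N x) \<le> norm x * K)"

text \<open>
  For bounded operators on a Hilbert space the described map exists (by the Riesz representation
  theorem) and is unique.
\<close>

definition cadjoint :: "('a::chilbert_space \<Rightarrow> 'a) \<Rightarrow> 'a \<Rightarrow> 'a"
  where "cadjoint N = (THE G. \<forall>x y. cinner (N x) y = cinner x (G y))"

definition normal_operators :: "('a::chilbert_space \<Rightarrow> 'a) set"
  where "normal_operators = {N. bounded_clinear N \<and> cadjoint N \<circ> N = N \<circ> cadjoint N}"

definition unitary_operator :: "('a::chilbert_space \<Rightarrow> 'a) \<Rightarrow> bool"
  where "unitary_operator V \<longleftrightarrow>
    bounded_clinear V \<and> cadjoint V \<circ> V = id \<and> V \<circ> cadjoint V = id"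

definition unitarily_equivalent ::
    "('a::chilbert_space \<Rightarrow> 'a) \<Rightarrow> ('a \<Rightarrow> 'a) \<Rightarrow> bool"
  where "unitarily_equivalent N M \<longleftrightarrow> (\<exists>V. unitary_operator V \<and> M = inv V \<circ> N \<circ> V)"

definition normal_unitary_classes :: "('a::chilbert_space \<Rightarrow> 'a) set set"
  where "normal_unitary_classes = normal_operators //
    {(N, M). N \<in> normal_operators \<and> M \<in> normal_operators \<and> unitarily_equivalent N M}"

end

theory Submission
  imports Defs
begin

text \<open>
  A continuous map on a separable metric space is determined by which of its values on a countable
  dense set lie within \<open>1 / (n + 1)\<close> of which points of that set, that is, by a subset of a
  countable set; so there are at most continuum many bounded operators. Conversely, a scalar
  operator commutes with every unitary, so distinct real multiples of the identity lie in distinct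
  unitary equivalence classes.
\<close>

lemma continuous_maps_lepoll_reals:
  assumes "separable_space (euclidean :: 'a::metric_space topology)"
  shows "{f :: 'a \<Rightarrow> 'a. continuous_on UNIV f} \<lesssim> (UNIV :: real set)"
proof -
  obtain D :: "'a set" where D: "countable D" "closure D = UNIV"
    using assms by (auto simp: separable_space_def)
  define code :: "('a \<Rightarrow> 'a) \<Rightarrow> ('a \<times> 'a \<times> nat) set" where
    "code f = {(x, y, n). x \<in> D \<and> y \<in> D \<and> dist (f x) y < 1 / real (Suc n)}" for f
  have "inj_on code {f. continuous_on UNIV f}"
  proof (rule inj_onI, clarify)
    fix f g :: "'a \<Rightarrow> 'a"
    assume f: "continuous_on UNIV f" and g: "continuous_on UNIV g" and eq: "code f = code g"
    have "f x = g x" if "x \<in> D" for x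
    proof (rule ccontr)
      assume "f x \<noteq> g x"
      \<comment> \<open>Half the distance, because the triangle inequality through \<open>y\<close>
        adds two errors, each below \<open>1 / real (Suc n)\<close>.\<close>
      then have "0 < dist (f x) (g x) / 2"
        by simp
      then obtain n where n: "1 / real (Suc n) < dist (f x) (g x) / 2"
        by (metis nat_approx_posE)
      \<comment> \<open>Density is applied to the value \<open>f x\<close>, which need not lie in
        \<open>D\<close> itself.\<close>
      obtain y where y: "y \<in> D" "dist (f x) y < 1 / real (Suc n)"
        using D(2) closure_approachable[of "f x" D]
        by (metis UNIV_I dist_commute of_nat_0_less_iff zero_less_Suc zero_less_divide_1_iff)
      then have "(x, y, n) \<in> code f"
        using \<open>x \<in> D\<close> by (simp add: code_def)
      then have "dist (g x) y < 1 / real (Suc n)"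
        unfolding eq by (simp add: code_def)
      then show False
        using dist_triangle2[of "f x" "g x" y] y(2) n by linarith
    qed
    \<comment> \<open>The agreement set of two continuous maps into a metric space is closed, so
      containing \<open>D\<close> it contains the whole space.\<close>
    then have "D \<subseteq> {x. f x = g x}"
      by auto
    then have "closure D \<subseteq> {x. f x = g x}"
      by (intro closure_minimal closed_Collect_eq f g)
    then show "f = g"
      using D(2) by auto
  qed
  moreover have "code ` {f. continuous_on UNIV f} \<subseteq> Pow (D \<times> D \<times> UNIV)"
    by (auto simp: code_def)
  ultimately have "{f :: 'a \<Rightarrow> 'a. continuous_on UNIV f} \<lesssim> Pow (D \<times> D \<times> (UNIV :: nat set))"
    unfolding lepoll_def by blast
  also have "\<dots> \<lesssim> (UNIV :: nat set set)"
  proof -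
    have "countable (D \<times> D \<times> (UNIV :: nat set))"
      using D(1) by auto
    then obtain h :: "'a \<times> 'a \<times> nat \<Rightarrow> nat" where "inj_on h (D \<times> D \<times> UNIV)"
      by (rule countableE)
    then have "inj_on ((`) h) (Pow (D \<times> D \<times> UNIV))"
      by (rule inj_on_image_Pow)
    then show ?thesis
      unfolding lepoll_def by blast
  qed
  also have "\<dots> \<approx> (UNIV :: real set)"
    by (rule nat_sets_eqpoll_reals)
  finally show ?thesis .
qed

text \<open>Restricting the scalars to the reals turns \<open>N\<close> into a
  \<open>bounded_linear\<close> map, for which continuity is known.\<close>

lemma bounded_clinear_imp_continuous_on:
  fixes N :: "'a::complex_inner \<Rightarrow> 'b::complex_inner"
  assumes "bounded_clinear N"
  shows "continuous_on S N"
proof -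
  interpret Vector_Spaces.linear scaleC scaleC N
    using assms by (simp add: bounded_clinear_def)
  have "bounded_linear N"
  proof
    show "N (r *\<^sub>R x) = r *\<^sub>R N x" for r x
      by (simp add: scaleR_scaleC scale)
    show "\<exists>K. \<forall>x. norm (N x) \<le> norm x * K"
      using assms by (simp add: bounded_clinear_def)
  qed (rule add)
  then show ?thesis
    by (intro linear_continuous_on)
qed

lemma cinner_right_eqI:
  fixes y z :: "'a::complex_inner"
  assumes "\<And>x. cinner x y = cinner x z"
  shows "y = z"
proof -
  have "cinner y x = cinner z x" for x
    by (metis assms cinner_commute)
  \<comment> \<open>The hypothesis, moved to the first argument by conjugate symmetry, is tested
    against \<open>y - z\<close>; \<open>cinner_norm\<close> then gives definiteness.\<close>
  then have "cinner (y - z) (y - z) = 0"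
    using cinner_add_left[of "y - z" z "y - z"] by simp
  then show ?thesis
    by (simp add: cinner_norm)
qed

text \<open>The given \<open>G\<close> supplies existence for the definite description in
  \<open>cadjoint\<close>; uniqueness holds because inner products determine a vector.\<close>

lemma cadjoint_eqI:
  fixes N :: "'a::chilbert_space \<Rightarrow> 'a"
  assumes "\<And>x y. cinner (N x) y = cinner x (G y)"
  shows "cadjoint N = G"
  unfolding cadjoint_def
proof (rule the_equality)
  fix G' assume "\<forall>x y. cinner (N x) y = cinner x (G' y)"
  then have "cinner x (G' y) = cinner x (G y)" for x y
    using assms by metis
  then show "G' = G"
    by (intro ext cinner_right_eqI[of "G' _"])
qed (use assms in blast)

lemma cadjoint_scaleC:
  "cadjoint ((*\<^sub>C) c) = ((*\<^sub>C) (cnj c) :: 'a::chilbert_space \<Rightarrow> 'a)"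
proof (rule cadjoint_eqI)
  fix x y :: 'a
  have "cinner x (cnj c *\<^sub>C y) = cnj (cinner (cnj c *\<^sub>C y) x)"
    by (rule cinner_commute)
  also have "\<dots> = c * cnj (cinner y x)"
    by (simp add: cinner_scaleC_left)
  also have "\<dots> = c * cinner x y"
    by (simp only: cinner_commute[of x y])
  finally show "cinner (c *\<^sub>C x) y = cinner x (cnj c *\<^sub>C y)"
    by (simp only: cinner_scaleC_left)
qed

text \<open>The norm axioms give homogeneity for real scalars only. For complex \<open>c\<close> it
  comes from the form, out of which \<open>c\<close> and \<open>cnj c\<close> factor with product
  \<open>(cmod c)\<^sup>2\<close>.\<close>

lemma norm_scaleC: "norm (c *\<^sub>C x) = cmod c * norm (x :: 'a::complex_inner)"
proof -
  have "complex_of_real ((norm (c *\<^sub>C x))\<^sup>2) = c * cinner x (c *\<^sub>C x)"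
    by (simp only: cinner_norm[symmetric] cinner_scaleC_left)
  also have "cinner x (c *\<^sub>C x) = cnj c * cinner x x"
    by (metis cinner_commute cinner_scaleC_left complex_cnj_mult)
  also have "c * (cnj c * cinner x x) = complex_of_real ((cmod c * norm x)\<^sup>2)"
    by (simp add: cinner_norm power_mult_distrib flip: complex_norm_square mult.assoc)
  finally have "(norm (c *\<^sub>C x))\<^sup>2 = (cmod c * norm x)\<^sup>2"
    by (simp only: of_real_eq_iff)
  then show ?thesis
    by (simp add: power2_eq_iff_nonneg)
qed

lemma bounded_clinear_scaleC: "bounded_clinear ((*\<^sub>C) c :: 'a::complex_inner \<Rightarrow> 'a)"
proof -
  have "Vector_Spaces.linear (*\<^sub>C) (*\<^sub>C) ((*\<^sub>C) c :: 'a \<Rightarrow> 'a)"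
    by unfold_locales (simp_all add: scaleC_add_right scaleC_scaleC mult.commute)
  moreover have "\<forall>x::'a. norm (c *\<^sub>C x) \<le> norm x * cmod c"
    by (simp add: norm_scaleC)
  ultimately show ?thesis
    unfolding bounded_clinear_def by blast
qed

lemma scaleC_normal_operator: "(*\<^sub>C) c \<in> normal_operators"
  by (simp add: normal_operators_def bounded_clinear_scaleC cadjoint_scaleC fun_eq_iff
      scaleC_scaleC mult.commute)

lemma unitary_operator_id: "unitary_operator (id :: 'a::chilbert_space \<Rightarrow> 'a)"
proof -
  \<comment> \<open>Viewing the identity as scaling by 1 yields its boundedness and its adjoint from
    the scalar case.\<close>
  have "((*\<^sub>C) 1 :: 'a \<Rightarrow> 'a) = id"
    by auto
  then show ?thesis
    using bounded_clinear_scaleC[of 1, where 'a = 'a] cadjoint_scaleC[of 1, where 'a = 'a]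
    by (simp add: unitary_operator_def)
qed

lemma unitarily_equivalent_refl: "unitarily_equivalent N N"
  unfolding unitarily_equivalent_def using unitary_operator_id by (intro exI[of _ id]) simp

text \<open>Linearity moves the scaling through \<open>V\<close>, after which \<open>inv V\<close>
  cancels \<open>V\<close>. Thus the class of a scalar operator is a singleton.\<close>

lemma unitarily_equivalent_scaleC:
  assumes "unitarily_equivalent ((*\<^sub>C) c) M"
  shows "M = (*\<^sub>C) c"
proof -
  obtain V where V: "unitary_operator V" and M: "M = inv V \<circ> (*\<^sub>C) c \<circ> V"
    using assms by (auto simp: unitarily_equivalent_def)
  interpret Vector_Spaces.linear scaleC scaleC V
    using V by (simp add: unitary_operator_def bounded_clinear_def)
  \<comment> \<open>The adjoint is a left inverse of \<open>V\<close>.\<close>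
  have "inj V"
    using V by (metis inj_on_id inj_on_imageI2 unitary_operator_def)
  then show ?thesis
    unfolding M by (simp add: fun_eq_iff inv_f_f flip: scale)
qed

theorem proposition4p4:
  assumes separable: "separable_space (euclidean :: 'a::chilbert_space topology)"
    and infinite_dimensional: "\<not> (\<exists>B :: 'a set. finite B \<and> complex_vector.span B = UNIV)"
  shows "(normal_unitary_classes :: ('a \<Rightarrow> 'a) set set) \<approx> (UNIV :: real set)"
proof (rule lepoll_antisym)
  let ?R = "{(N, M :: 'a \<Rightarrow> 'a).
    N \<in> normal_operators \<and> M \<in> normal_operators \<and> unitarily_equivalent N M}"
  \<comment> \<open>As an image of \<open>normal_operators\<close>, the set of classes is at most as
    large as that set.\<close>
  have classes: "normal_unitary_classes = (\<lambda>N. ?R `` {N}) ` normal_operators"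
    by (auto simp: normal_unitary_classes_def quotient_def)
  have "(normal_unitary_classes :: ('a \<Rightarrow> 'a) set set) \<lesssim> (normal_operators :: ('a \<Rightarrow> 'a) set)"
    unfolding classes by (rule image_lepoll)
  also have "\<dots> \<lesssim> {f :: 'a \<Rightarrow> 'a. continuous_on UNIV f}"
    by (rule subset_imp_lepoll)
      (auto simp: normal_operators_def intro: bounded_clinear_imp_continuous_on)
  also have "\<dots> \<lesssim> (UNIV :: real set)"
    by (rule continuous_maps_lepoll_reals[OF separable])
  finally show "(normal_unitary_classes :: ('a \<Rightarrow> 'a) set set) \<lesssim> (UNIV :: real set)" .

  \<comment> \<open>The empty set is finite and spans only 0, so infinite dimension yields a nonzero
    vector, on which different real scalars act differently.\<close>
  obtain x :: 'a where "x \<noteq> 0"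
  proof -
    have "complex_vector.span {} \<noteq> (UNIV :: 'a set)"
      using infinite_dimensional by blast
    then show ?thesis
      using that by auto
  qed
  have "inj (\<lambda>r. ?R `` {(*\<^sub>C) (complex_of_real r)})"
  proof (rule injI)
    fix r s :: real
    assume eq: "?R `` {(*\<^sub>C) (complex_of_real r)} = ?R `` {(*\<^sub>C) (complex_of_real s)}"
    \<comment> \<open>By reflexivity the second class contains its representative; equality of the
      classes puts it in the first.\<close>
    have "(*\<^sub>C) (complex_of_real s) \<in> ?R `` {(*\<^sub>C) (complex_of_real s)}"
      by (simp add: scaleC_normal_operator unitarily_equivalent_refl)
    then have "unitarily_equivalent ((*\<^sub>C) (complex_of_real r))
        ((*\<^sub>C) (complex_of_real s) :: 'a \<Rightarrow> 'a)"
      unfolding eq[symmetric] by simp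
    then have "((*\<^sub>C) (complex_of_real s) :: 'a \<Rightarrow> 'a) = (*\<^sub>C) (complex_of_real r)"
      by (rule unitarily_equivalent_scaleC)
    then have "s *\<^sub>R x = r *\<^sub>R x"
      by (metis scaleR_scaleC)
    then show "r = s"
      using \<open>x \<noteq> 0\<close> by simp
  qed
  moreover have "range (\<lambda>r. ?R `` {(*\<^sub>C) (complex_of_real r)}) \<subseteq> normal_unitary_classes"
    unfolding classes using scaleC_normal_operator by blast
  ultimately show "(UNIV :: real set) \<lesssim> (normal_unitary_classes :: ('a \<Rightarrow> 'a) set set)"
    unfolding lepoll_def by blast
qed

end
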